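(* Let $(\alpha_1,\dots,\alpha_m)\in[0,1]^m$ with $\sum_{k=1}^m\alpha_k=1$, let $x_1,\dots,x_m\in\mathbb{R}^d$, and define $Af:=\sum_{k=1}^m\alpha_kf(\cdot-x_k)$ for functions $f:\mathbb{R}^d\to\mathbb{R}$. Let $c\in(0,1)$ and let $g,h:\mathbb{R}^d\to\mathbb{R}$ be measurable with $Ag\ge g$, $Ah=h$ and $0\vee g\le h$. Define $\mathcal{D}f:=(c\cdot Af)\vee g$ for nonnegative measurable $f$, and let $Q:=\{f\le h\ :\ Af\ge f\}$. Then for all $n\in\mathbb{N}_0$, $$\mathcal{D}^{n+1}(g\vee0)\ge\mathcal{D}^n(g\vee0).$$ Furthermore, $$q:=\lim_{n\to\infty}\mathcal{D}^n(g\vee0)=\sup_{n\in\mathbb{N}_0}\mathcal{D}^n(g\vee0)\in Q,$$ and $q$ is the smallest nonnegative fixed point of $\mathcal{D}$.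
   Context: All inequalities between functions, suprema and limits are pointwise; $\vee$ is the pointwise maximum; $\mathcal{D}^n$ is the $n$-fold composition of $\mathcal{D}$. *)

theory Defs
  imports "HOL-Analysis.Analysis"
begin

definition shift_avg ::
  "nat \<Rightarrow> (nat \<Rightarrow> real) \<Rightarrow> (nat \<Rightarrow> real ^ 'd) \<Rightarrow> (real ^ 'd \<Rightarrow> real) \<Rightarrow> (real ^ 'd \<Rightarrow> real)"
  where "shift_avg m \<alpha> x f = (\<lambda>y. \<Sum>k=1..m. \<alpha> k * f (y - x k))"

text \<open>The domain on which the operator \<open>dyn_op\<close> below is meant to act. Measurable means
  Borel measurable throughout.\<close>

definition nonneg_measurable :: "(real ^ 'd \<Rightarrow> real) set"
  where "nonneg_measurable = {f. f \<in> borel_measurable borel \<and> (\<forall>y. 0 \<le> f y)}"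

text \<open>HOL functions are total, so \<open>dyn_op\<close> is also given by this formula outside
  \<open>nonneg_measurable\<close>; statements about its fixed points must restrict to that set.\<close>

definition dyn_op ::
  "((real ^ 'd \<Rightarrow> real) \<Rightarrow> (real ^ 'd \<Rightarrow> real)) \<Rightarrow> real \<Rightarrow> (real ^ 'd \<Rightarrow> real)
    \<Rightarrow> (real ^ 'd \<Rightarrow> real) \<Rightarrow> (real ^ 'd \<Rightarrow> real)"
  where "dyn_op A c g f = (\<lambda>y. max (c * A f y) (g y))"

definition subinvariant_below ::
  "((real ^ 'd \<Rightarrow> real) \<Rightarrow> (real ^ 'd \<Rightarrow> real)) \<Rightarrow> (real ^ 'd \<Rightarrow> real) \<Rightarrow> (real ^ 'd \<Rightarrow> real) set"
  where "subinvariant_below A h = {f. f \<le> h \<and> f \<le> A f}"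

definition nonneg_fixed_points ::
  "((real ^ 'd \<Rightarrow> real) \<Rightarrow> (real ^ 'd \<Rightarrow> real)) \<Rightarrow> (real ^ 'd \<Rightarrow> real) set"
  where "nonneg_fixed_points D = {f \<in> nonneg_measurable. D f = f}"

end

theory Submission
  imports Defs
begin

text \<open>
  Write \<open>D\<close> for the dynamic programming operator and \<open>g0\<close> for \<open>g \<or> 0\<close>. The averaging operator
  \<open>A\<close> has nonnegative weights, so it is monotone and preserves nonnegativity; being a finite sum,
  it commutes with pointwise limits. Hence \<open>D\<close> is monotone and pointwise continuous, and the proof
  is a monotone iteration from below.

  The start lies below its image: \<open>D g0 \<ge> g\<close> holds by definition of \<open>D\<close>, and \<open>D g0 \<ge> c A g0 \<ge> 0\<close>
  because \<open>g0 \<ge> 0\<close>. Monotonicity propagates this to all iterates, which therefore increase. They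
  stay below \<open>h\<close>: if \<open>f \<le> h\<close>, then \<open>c A f \<le> c A h = c h \<le> h\<close>, using \<open>h \<ge> 0\<close>, and \<open>g \<le> h\<close>. So they
  converge pointwise to their supremum \<open>q \<le> h\<close>, and continuity of \<open>D\<close> makes \<open>q\<close> a fixed point.

  For subinvariance, split \<open>q = c A q \<or> g\<close>: the first term is at most \<open>A q\<close> since \<open>A q \<ge> 0\<close> and
  \<open>c \<le> 1\<close>, the second since \<open>g \<le> A g \<le> A q\<close>. For minimality, a nonnegative fixed point \<open>f\<close> satisfies
  \<open>f = D f \<ge> g\<close>, hence \<open>f \<ge> g0\<close>, and applying \<open>D\<close> repeatedly yields \<open>f \<ge> D\<^sup>n g0\<close> for all \<open>n\<close>.
\<close>

lemma shift_avg_mono: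
  assumes "\<And>k. k \<in> {1..m} \<Longrightarrow> 0 \<le> \<alpha> k" and "f \<le> f'"
  shows "shift_avg m \<alpha> x f \<le> shift_avg m \<alpha> x f'"
  unfolding shift_avg_def using assms
  by (intro le_funI sum_mono mult_left_mono) (auto simp: le_fun_def)

lemma shift_avg_nonneg:
  assumes "\<And>k. k \<in> {1..m} \<Longrightarrow> 0 \<le> \<alpha> k" and "\<And>y. 0 \<le> f y"
  shows "0 \<le> shift_avg m \<alpha> x f y"
  unfolding shift_avg_def using assms by (intro sum_nonneg mult_nonneg_nonneg) auto

lemma shift_avg_measurable:
  assumes [measurable]: "f \<in> borel_measurable borel"
  shows "shift_avg m \<alpha> x f \<in> borel_measurable borel"
  unfolding shift_avg_def by measurable

lemma shift_avg_tendsto: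
  assumes "\<And>y. (\<lambda>n. F n y) \<longlonglongrightarrow> f y"
  shows "(\<lambda>n. shift_avg m \<alpha> x (F n) y) \<longlonglongrightarrow> shift_avg m \<alpha> x f y"
  unfolding shift_avg_def by (intro tendsto_intros assms)

lemma mono_dyn_op:
  assumes "mono A" and "0 \<le> c"
  shows "mono (dyn_op A c g)"
  unfolding dyn_op_def using assms
  by (intro monoI le_funI max.mono mult_left_mono) (auto simp: mono_def le_fun_def)

lemma dyn_op_measurable:
  assumes "A f \<in> borel_measurable borel" and "g \<in> borel_measurable borel"
  shows "dyn_op A c g f \<in> borel_measurable borel"
  unfolding dyn_op_def using assms by measurable

lemma dyn_op_tendsto:
  assumes "(\<lambda>n. A (F n) y) \<longlonglongrightarrow> A f y"
  shows "(\<lambda>n. dyn_op A c g (F n) y) \<longlonglongrightarrow> dyn_op A c g f y"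
  unfolding dyn_op_def by (intro tendsto_intros assms)

text \<open>
  Monotonicity and \<open>A h = h\<close> bound \<open>c A f\<close> only by \<open>c h\<close>; the sign of \<open>h\<close> then gives
  \<open>c h \<le> h\<close>.
\<close>

lemma dyn_op_le_invariant:
  assumes "mono A" and "0 \<le> c" and "c \<le> 1" and "A h = h"
    and "\<And>y. 0 \<le> h y" and "g \<le> h" and "f \<le> h"
  shows "dyn_op A c g f \<le> h"
proof (rule le_funI)
  fix y
  have "A f y \<le> h y"
    using monoD[OF \<open>mono A\<close> \<open>f \<le> h\<close>] \<open>A h = h\<close> by (simp add: le_fun_def)
  then have "c * A f y \<le> c * h y"
    using \<open>0 \<le> c\<close> by (rule mult_left_mono)
  also have "\<dots> \<le> h y"
    using assms by (simp add: mult_left_le_one_le)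
  finally show "dyn_op A c g f y \<le> h y"
    using \<open>g \<le> h\<close> by (simp add: dyn_op_def le_fun_def)
qed

text \<open>
  Post-composing the inequality \<open>f \<le> D f\<close> with the monotone \<open>n\<close>-th power of \<open>D\<close> shifts it
  along the orbit.
\<close>

lemma funpow_mono_increasing:
  fixes D :: "'a::order \<Rightarrow> 'a"
  assumes "mono D" and "f \<le> D f"
  shows "(D ^^ n) f \<le> (D ^^ (n + 1)) f"
  using funpow_mono[OF assms, of n] by (simp add: funpow_swap1)

lemma funpow_le_fixed_point:
  fixes D :: "'a::order \<Rightarrow> 'a"
  assumes "mono D" and "f \<le> p" and "D p = p"
  shows "(D ^^ n) f \<le> p"
proof -
  have "(D ^^ n) p = p"
    by (induction n) (simp_all add: \<open>D p = p\<close>)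
  then show ?thesis
    using funpow_mono[OF assms(1,2), of n] by simp
qed

theorem theorem6p1:
  fixes m :: nat and \<alpha> :: "nat \<Rightarrow> real" and x :: "nat \<Rightarrow> real ^ 'd"
    and c :: real and g h :: "real ^ 'd \<Rightarrow> real"
  defines "A \<equiv> shift_avg m \<alpha> x"
  defines "D \<equiv> dyn_op A c g"
  defines "g0 \<equiv> (\<lambda>y. max (g y) 0)"
  defines "q \<equiv> (\<lambda>y. lim (\<lambda>n. (D ^^ n) g0 y))"
  assumes "\<forall>k\<in>{1..m}. 0 \<le> \<alpha> k \<and> \<alpha> k \<le> 1"
    and "(\<Sum>k=1..m. \<alpha> k) = 1"
    and "0 < c" and "c < 1"
    and "g \<in> borel_measurable borel" and "h \<in> borel_measurable borel"
    and "g \<le> A g" and "A h = h" and "\<forall>y. max 0 (g y) \<le> h y"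
  shows "(\<forall>n. (D ^^ n) g0 \<le> (D ^^ (n + 1)) g0)
    \<and> (\<forall>y. convergent (\<lambda>n. (D ^^ n) g0 y))
    \<and> (\<forall>y. bdd_above (range (\<lambda>n. (D ^^ n) g0 y)) \<and> q y = (SUP n. (D ^^ n) g0 y))
    \<and> q \<in> subinvariant_below A h
    \<and> q \<in> nonneg_fixed_points D
    \<and> (\<forall>f \<in> nonneg_fixed_points D. q \<le> f)"
proof -
  define F where "F n = (D ^^ n) g0" for n
  have weights: "0 \<le> \<alpha> k" if "k \<in> {1..m}" for k
    using assms(5) that by blast
  have A_mono: "mono A"
    unfolding A_def by (intro monoI shift_avg_mono weights)
  have D_mono: "mono D"
    unfolding D_def using A_mono \<open>0 < c\<close> by (intro mono_dyn_op) auto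
  have h_nonneg: "0 \<le> h y" and g_le_h: "g \<le> h" and g0_le_h: "g0 \<le> h" for y
    using \<open>\<forall>y. max 0 (g y) \<le> h y\<close> by (auto simp: le_fun_def g0_def)
  have F_0: "F 0 = g0" and F_Suc: "F (Suc n) = D (F n)" for n
    by (simp_all add: F_def)

  have "g0 \<le> D g0"
  proof (rule le_funI)
    fix y
    have "0 \<le> A g0 y"
      unfolding A_def by (rule shift_avg_nonneg[OF weights]) (auto simp: g0_def)
    then have "0 \<le> c * A g0 y"
      using \<open>0 < c\<close> by simp
    then show "g0 y \<le> D g0 y"
      by (auto simp: D_def dyn_op_def g0_def)
  qed
  then have step: "F n \<le> F (n + 1)" for n
    unfolding F_def by (rule funpow_mono_increasing[OF D_mono])
  then have inc: "incseq (\<lambda>n. F n y)" for y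
    by (auto intro!: incseq_SucI simp: le_fun_def)

  have F_le_h: "F n \<le> h" for n
  proof (induction n)
    case 0
    show ?case using g0_le_h by (simp add: F_0)
  next
    case (Suc n)
    show ?case
      unfolding F_Suc D_def
      using A_mono \<open>0 < c\<close> \<open>c < 1\<close> \<open>A h = h\<close> h_nonneg g_le_h Suc
      by (intro dyn_op_le_invariant) auto
  qed
  then have bdd: "bdd_above (range (\<lambda>n. F n y))" for y
    by (auto intro!: bdd_aboveI[of _ "h y"] simp: le_fun_def)

  have lim_SUP: "(\<lambda>n. F n y) \<longlonglongrightarrow> (SUP n. F n y)" for y
    by (rule LIMSEQ_incseq_SUP[OF bdd inc])
  have q_SUP: "q y = (SUP n. F n y)" for y
    using limI[OF lim_SUP] by (simp add: q_def F_def)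
  have lim_q: "(\<lambda>n. F n y) \<longlonglongrightarrow> q y" for y
    using lim_SUP by (simp add: q_SUP)
  have q_least: "q \<le> p" if "\<And>n. F n \<le> p" for p
    unfolding le_fun_def q_SUP using that by (auto intro!: cSUP_least simp: le_fun_def)
  have "F 0 \<le> q"
    unfolding le_fun_def q_SUP using bdd by (auto intro: cSUP_upper)
  then have g0_le_q: "g0 \<le> q"
    by (simp add: F_0)
  then have q_nonneg: "0 \<le> q y" and g_le_q: "g \<le> q" for y
    by (auto simp: le_fun_def g0_def)

  have q_fixed: "D q = q"
  proof
    fix y
    have "(\<lambda>n. D (F n) y) \<longlonglongrightarrow> D q y"
      unfolding D_def A_def by (intro dyn_op_tendsto shift_avg_tendsto lim_q)
    moreover have "(\<lambda>n. D (F n) y) \<longlonglongrightarrow> q y"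
      using LIMSEQ_Suc[OF lim_q] by (simp add: F_Suc)
    ultimately show "D q y = q y"
      by (rule LIMSEQ_unique)
  qed

  have F_measurable: "F n \<in> borel_measurable borel" for n
  proof (induction n)
    case 0
    show ?case unfolding F_0 g0_def using \<open>g \<in> borel_measurable borel\<close> by measurable
  next
    case (Suc n)
    then show ?case
      unfolding F_Suc D_def A_def using \<open>g \<in> borel_measurable borel\<close>
      by (intro dyn_op_measurable shift_avg_measurable)
  qed
  have "q \<in> borel_measurable borel"
    by (rule borel_measurable_LIMSEQ_real[OF _ F_measurable]) (rule lim_q)
  then have q_fp: "q \<in> nonneg_fixed_points D"
    using q_nonneg q_fixed by (simp add: nonneg_fixed_points_def nonneg_measurable_def)

  have "q \<le> A q"
  proof (rule le_funI)
    fix y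
    have "0 \<le> A q y"
      unfolding A_def by (intro shift_avg_nonneg weights q_nonneg)
    then have "c * A q y \<le> A q y"
      using \<open>0 < c\<close> \<open>c < 1\<close> by (simp add: mult_left_le_one_le)
    moreover have "g y \<le> A q y"
      using order_trans[OF \<open>g \<le> A g\<close> monoD[OF A_mono g_le_q]] by (simp add: le_fun_def)
    ultimately have "D q y \<le> A q y"
      by (simp add: D_def dyn_op_def)
    then show "q y \<le> A q y"
      by (simp add: q_fixed)
  qed
  then have q_sub: "q \<in> subinvariant_below A h"
    using q_least[OF F_le_h] by (simp add: subinvariant_below_def)

  have q_smallest: "q \<le> f" if "f \<in> nonneg_fixed_points D" for f
  proof -
    from that have "D f = f" and f_nonneg: "\<And>y. 0 \<le> f y"
      by (auto simp: nonneg_fixed_points_def nonneg_measurable_def)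
    have "g y \<le> D f y" for y
      by (simp add: D_def dyn_op_def)
    then have "g0 \<le> f"
      using \<open>D f = f\<close> f_nonneg by (simp add: le_fun_def g0_def)
    then have "F n \<le> f" for n
      unfolding F_def using D_mono \<open>D f = f\<close> by (intro funpow_le_fixed_point)
    then show "q \<le> f"
      by (rule q_least)
  qed
  have conv: "convergent (\<lambda>n. F n y)" for y
    using lim_q by (rule convergentI)
  show ?thesis
    by (intro conjI allI ballI step[unfolded F_def] conv[unfolded F_def] bdd[unfolded F_def]
        q_SUP[unfolded F_def] q_sub q_fp q_smallest)
qed

end
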